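(* Let $n\ge 2$, let $X=\sum_{i=1}^n a_i\,\partial/\partial\theta_i$ be a constant vector field on $T^n$ whose coefficients $a_1,\dots,a_n\in\mathbb{R}$ are independent over $\mathbb{Q}$, and let $\phi$ be the flow on $T^n$ generated by $X$. Then each $\alpha\in\rho_\phi(S_\phi)$ is a real algebraic integer of degree at most $n$, and $\rho_\phi(S_\phi)\cap\mathbb{Q}=\{1,-1\}$.
   Context: $T^n=\mathbb{R}^n/\mathbb{Z}^n$ with coordinates $\theta_i=x_i\bmod 1$. $\mathrm{Diff}(T^n)$ is the group of $C^\infty$ diffeomorphisms of $T^n$. Real numbers $a_1,\dots,a_n$ are independent over $\mathbb{Q}$ if $\sum_j m_ja_j=0$ with $m_j\in\mathbb{Z}$ implies all $m_j=0$. For a flow $\phi$ generated by $X$, $F_\phi=\{\phi_t:t\in\mathbb{R}\}$ and $S_\phi$ is the normalizer of $F_\phi$ in $\mathrm{Diff}(T^n)$. For $R\in\mathrm{Diff}(T^n)$, $R_*X=\mathbf{T}R\circ X\circ R^{-1}$, where $\mathbf{T}$ is the tangent functor. It is known that $R\in S_\phi$ if and only if there is a unique $\alpha\in\mathbb{R}^*=\mathbb{R}\setminus\{0\}$ with $R_*X=\alpha X$ (equivalently $R\phi_t=\phi_{\alpha t}R$ for all $t$); the homomorphism $\rho_\phi:S_\phi\to\mathbb{R}^*$ sends $R$ to this $\alpha$. An algebraic integer has degree $m$ if $m$ is the smallest degree of a monic polynomial in $\mathbb{Z}[z]$ of which it is a root. *)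

theory Defs
  imports
    "HOL-Analysis.Analysis"
    "HOL-Algebra.Group_Action"
    "HOL-Computational_Algebra.Polynomial"
begin

definition integer_translate :: "real ^ 'n \<Rightarrow> real ^ 'n \<Rightarrow> bool" where
  "integer_translate x y \<longleftrightarrow> (\<forall>i. x $ i - y $ i \<in> \<int>)"

lemma equivp_integer_translate: "equivp integer_translate"
proof (rule equivpI)
  show "reflp integer_translate"
    by (simp add: reflp_def integer_translate_def)
  show "symp integer_translate"
    unfolding symp_def integer_translate_def
    by (metis Ints_minus minus_diff_eq)
  show "transp integer_translate"
    unfolding transp_def integer_translate_def
    by (metis Ints_add add_diff_eq diff_add_cancel)
qed

text \<open>The torus of dimension \<open>CARD('n)\<close>; the quotient map from \<open>real ^ 'n\<close> is \<^term>\<open>abs_torus\<close>.\<close>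

quotient_type (overloaded) 'n torus = "real ^ ('n::finite)" / integer_translate
  by (rule equivp_integer_translate)

primrec times_differentiable_on ::
  "nat \<Rightarrow> ('a::real_normed_vector) set \<Rightarrow> ('a \<Rightarrow> 'b::real_normed_vector) \<Rightarrow> bool"
where
  "times_differentiable_on 0 S f \<longleftrightarrow> continuous_on S f"
| "times_differentiable_on (Suc k) S f \<longleftrightarrow>
     (\<forall>x\<in>S. f differentiable (at x)) \<and>
     (\<forall>v. times_differentiable_on k S (\<lambda>x. frechet_derivative f (at x) v))"

text \<open>On an open subset of a Euclidean space, \<^term>\<open>times_differentiable_on k S f\<close> is the class
  \<open>C\<^sup>k\<close>, so the following is \<open>C\<^sup>\<infinity>\<close>. It is only used for open \<^term>\<open>S\<close>.\<close>

definition smooth_on ::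
  "('a::real_normed_vector) set \<Rightarrow> ('a \<Rightarrow> 'b::real_normed_vector) \<Rightarrow> bool" where
  "smooth_on S f \<longleftrightarrow> (\<forall>k. times_differentiable_on k S f)"

text \<open>The charts of the torus are the local inverses of the quotient map, so a coordinate
  expression of \<^term>\<open>f\<close> is a map \<^term>\<open>g\<close> between open sets of \<open>real ^ 'n\<close> that lifts \<^term>\<open>f\<close>.
  A differentiable (hence continuous) local lift is determined up to an integer translation near
  a point, so neither smoothness nor the derivative depends on the choice of lift.\<close>

definition local_lift ::
  "('n::finite torus \<Rightarrow> 'n torus) \<Rightarrow> (real ^ 'n) set \<Rightarrow> (real ^ 'n \<Rightarrow> real ^ 'n) \<Rightarrow> bool" where
  "local_lift f U g \<longleftrightarrow> open U \<and> (\<forall>y\<in>U. f (abs_torus y) = abs_torus (g y))"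

definition smooth_torus_map :: "('n::finite torus \<Rightarrow> 'n torus) \<Rightarrow> bool" where
  "smooth_torus_map f \<longleftrightarrow> (\<forall>x. \<exists>U g. x \<in> U \<and> local_lift f U g \<and> smooth_on U g)"

definition Diff :: "('n::finite torus \<Rightarrow> 'n torus) monoid" where
  "Diff = \<lparr>carrier = {f. bij f \<and> smooth_torus_map f \<and> smooth_torus_map (inv_into UNIV f)},
           mult = (\<lambda>f g. f \<circ> g), one = id\<rparr>"

text \<open>The tangent bundle is trivialised by the frame of coordinate fields
  \<open>\<partial>/\<partial>\<theta>\<^sub>i\<close>: the pair \<open>(p, v)\<close> is the tangent vector \<open>\<Sum>i. v $ i \<cdot> \<partial>/\<partial>\<theta>\<^sub>i\<close> at \<open>p\<close>.
  Vector fields are sections of this bundle.\<close>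

type_synonym 'n tangent = "'n torus \<times> (real ^ 'n)"

definition torus_derivative ::
  "('n::finite torus \<Rightarrow> 'n torus) \<Rightarrow> 'n torus \<Rightarrow> real ^ 'n \<Rightarrow> real ^ 'n" where
  "torus_derivative f p = (THE L. \<exists>x U g. abs_torus x = p \<and> x \<in> U \<and> local_lift f U g \<and>
     (g has_derivative L) (at x))"

definition tangent_map ::
  "('n::finite torus \<Rightarrow> 'n torus) \<Rightarrow> 'n tangent \<Rightarrow> 'n tangent" where
  "tangent_map f = (\<lambda>(p, v). (f p, torus_derivative f p v))"

definition pushforward ::
  "('n::finite torus \<Rightarrow> 'n torus) \<Rightarrow> ('n torus \<Rightarrow> 'n tangent) \<Rightarrow> ('n torus \<Rightarrow> 'n tangent)" where
  "pushforward f X = tangent_map f \<circ> X \<circ> inv_into UNIV f"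

definition scale_field ::
  "real \<Rightarrow> ('n::finite torus \<Rightarrow> 'n tangent) \<Rightarrow> ('n torus \<Rightarrow> 'n tangent)" where
  "scale_field \<alpha> X = (\<lambda>p. (fst (X p), \<alpha> *\<^sub>R snd (X p)))"

definition constant_field :: "real ^ 'n \<Rightarrow> 'n::finite torus \<Rightarrow> 'n tangent" where
  "constant_field a = (\<lambda>p. (p, a))"

definition has_velocity :: "(real \<Rightarrow> 'n::finite torus) \<Rightarrow> 'n tangent \<Rightarrow> real \<Rightarrow> bool" where
  "has_velocity c w t \<longleftrightarrow> c t = fst w \<and>
     (\<exists>J g. open J \<and> t \<in> J \<and> (\<forall>s\<in>J. c s = abs_torus (g s)) \<and>
        (g has_vector_derivative snd w) (at t))"

definition is_flow_of ::
  "(real \<Rightarrow> 'n::finite torus \<Rightarrow> 'n torus) \<Rightarrow> ('n torus \<Rightarrow> 'n tangent) \<Rightarrow> bool" where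
  "is_flow_of \<phi> X \<longleftrightarrow>
     (\<forall>p. \<phi> 0 p = p) \<and> (\<forall>p t. has_velocity (\<lambda>s. \<phi> s p) (X (\<phi> t p)) t)"

definition symmetry_group ::
  "(real \<Rightarrow> 'n::finite torus \<Rightarrow> 'n torus) \<Rightarrow> ('n torus \<Rightarrow> 'n torus) set" where
  "symmetry_group \<phi> = normalizer Diff (range \<phi>)"

text \<open>The flow determines its generating field, so the multiplier is indexed by the field.\<close>

definition multiplier ::
  "('n::finite torus \<Rightarrow> 'n tangent) \<Rightarrow> ('n torus \<Rightarrow> 'n torus) \<Rightarrow> real" where
  "multiplier X R = (THE \<alpha>. \<alpha> \<noteq> 0 \<and> pushforward R X = scale_field \<alpha> X)"

definition rationally_independent :: "real ^ 'n::finite \<Rightarrow> bool" where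
  "rationally_independent a \<longleftrightarrow>
     (\<forall>m :: 'n \<Rightarrow> int. (\<Sum>j\<in>UNIV. of_int (m j) * a $ j) = 0 \<longrightarrow> (\<forall>j. m j = 0))"

definition algebraic_int_degree :: "'a::field_char_0 \<Rightarrow> nat" where
  "algebraic_int_degree x = (LEAST m. \<exists>p :: int poly.
     lead_coeff p = 1 \<and> degree p = m \<and> poly (map_poly of_int p) x = 0)"

end

theory Submission
  imports Defs
begin

text \<open>
  In coordinates the flow is \<open>x \<mapsto> x + t a\<close>. Let \<open>R\<close> normalise it, and let \<open>G\<close> be a continuous
  lift of \<open>R\<close> to \<open>real ^ 'n\<close>. Then \<open>G (x + m) = G x + A m\<close> for integer vectors \<open>m\<close>, with an integer
  matrix \<open>A\<close>, and \<open>G (x + t a) - G x = s t a + k t\<close> is independent of \<open>x\<close>, with \<open>k t\<close> integral.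
  The left-hand side is additive in \<open>t\<close> and differs from \<open>t A a\<close> by a bounded amount, because
  \<open>x \<mapsto> G x - A x\<close> is periodic; hence it equals \<open>t A a\<close>. Rational independence makes \<open>k\<close> additive,
  so \<open>k = 0\<close> by divisibility of the reals. Thus \<open>A a = \<alpha> a\<close>: the multiplier is an eigenvalue
  of an integer matrix, and so is its inverse, by the same argument for the inverse of \<open>R\<close>. A rational multiplier
  is therefore a unit of the integers.
\<close>

section \<open>Circle coordinates on the torus\<close>

lemma cis_2pi_eq_iff: "cis (2 * pi * u) = cis (2 * pi * v) \<longleftrightarrow> u - v \<in> \<int>"
proof
  assume "cis (2 * pi * u) = cis (2 * pi * v)"
  then obtain n :: int where n: "\<i> * of_real (2 * pi * u) = \<i> * of_real (2 * pi * v) + (of_int (2 * n) * pi) * \<i>"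
    unfolding cis_conv_exp exp_eq by blast
  from arg_cong[OF n, of Im] have "2 * pi * (u - v) = 2 * pi * of_int n"
    by (simp add: algebra_simps)
  then have "u - v = of_int n" by simp
  then show "u - v \<in> \<int>" by simp
next
  assume "u - v \<in> \<int>"
  then have "cis (2 * pi * v) * cis (2 * pi * (u - v)) = cis (2 * pi * v)"
    by (simp only: cis_multiple_2pi mult_1_right)
  then show "cis (2 * pi * u) = cis (2 * pi * v)"
    by (simp add: cis_mult algebra_simps)
qed

lemma abs_torus_eq_iff: "abs_torus x = abs_torus y \<longleftrightarrow> (\<forall>i. x $ i - y $ i \<in> \<int>)"
  by (simp add: torus.abs_eq_iff integer_translate_def)

lemma abs_rep_torus: "abs_torus (rep_torus p) = p"
  by (rule Quotient3_abs_rep[OF Quotient3_torus])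

lemma abs_torus_surj: "\<exists>x. abs_torus x = p"
  using abs_rep_torus by blast

text \<open>The choice of representative is harmless, as the exponential forgets integers. These
  coordinates embed the torus in a product of unit circles, so that continuity and derivatives can
  be handled through complex functions.\<close>

definition circle_coord :: "'n \<Rightarrow> 'n::finite torus \<Rightarrow> complex" where
  "circle_coord i p = cis (2 * pi * (rep_torus p $ i))"

lemma circle_coord_abs [simp]: "circle_coord i (abs_torus x) = cis (2 * pi * (x $ i))"
proof -
  have "abs_torus (rep_torus (abs_torus x)) = abs_torus x"
    by (rule abs_rep_torus)
  then show ?thesis
    by (simp add: circle_coord_def cis_2pi_eq_iff abs_torus_eq_iff)
qed

lemma torus_eqI:
  assumes "\<And>i. circle_coord i p = circle_coord i q"
  shows "p = q"
proof -
  obtain x y where "p = abs_torus x" "q = abs_torus y"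
    using abs_torus_surj by metis
  with assms show ?thesis
    by (simp add: cis_2pi_eq_iff abs_torus_eq_iff)
qed

section \<open>Rigidity of integer vectors; derivatives, flows and lifts on the torus\<close>

lemma continuous_int_vector_const:
  fixes d :: "'a::real_normed_vector \<Rightarrow> real ^ 'n::finite"
  assumes "continuous_on UNIV d" and int: "\<And>x i. d x $ i \<in> \<int>"
  shows "d x = d y"
proof (rule vec_eq_iff[THEN iffD2], rule allI)
  fix i
  have "(\<lambda>x. d x $ i) constant_on UNIV"
  proof (rule continuous_discrete_range_constant)
    show "continuous_on UNIV (\<lambda>x. d x $ i)"
      using assms(1) by (rule continuous_on_component)
    fix x
    have "1 \<le> norm (d y $ i - d x $ i)" if "d y $ i \<noteq> d x $ i" for y
      using Ints_nonzero_abs_ge1[of "d y $ i - d x $ i"] int that by simp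
    then show "\<exists>e>0. \<forall>y. y \<in> UNIV \<and> d y $ i \<noteq> d x $ i \<longrightarrow> e \<le> norm (d y $ i - d x $ i)"
      by (intro exI[of _ 1]) auto
  qed (rule connected_UNIV)
  then show "d x $ i = d y $ i"
    unfolding constant_on_def by auto
qed

text \<open>Continuity at the single point \<open>x\<close> suffices: an integer vector of norm
  below 1 is zero. As \<open>nhds x\<close> sees \<open>x\<close> itself, \<open>d x\<close> is
  integral too.\<close>

lemma tendsto_int_vector_eventually_const:
  fixes d :: "'a::topological_space \<Rightarrow> real ^ 'n::finite"
  assumes "(d \<longlongrightarrow> d x) (nhds x)" and int: "\<forall>\<^sub>F y in nhds x. \<forall>i. d y $ i \<in> \<int>"
  shows "\<forall>\<^sub>F y in nhds x. d y = d x"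
proof -
  have "\<forall>\<^sub>F y in nhds x. dist (d y) (d x) < 1"
    using assms(1) by (rule tendstoD) simp
  then show ?thesis
    using int
  proof eventually_elim
    case (elim y)
    have "d y $ i = d x $ i" for i
    proof (rule ccontr)
      assume "d y $ i \<noteq> d x $ i"
      then have "1 \<le> \<bar>d y $ i - d x $ i\<bar>"
        using Ints_nonzero_abs_ge1[of "d y $ i - d x $ i"] elim(2) eventually_nhds_x_imp_x[OF int]
        by simp
      also have "\<dots> \<le> dist (d y) (d x)"
        using component_le_norm_cart[of "d y - d x" i] by (simp add: dist_norm)
      finally show False using elim(1) by simp
    qed
    then show ?case by (simp add: vec_eq_iff)
  qed
qed

text \<open>Two lifts may sit over different representatives of \<open>p\<close>. After translating
  one base point to the other, their difference is integral near \<open>x\<close> and continuous at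
  \<open>x\<close>, hence locally constant, so the derivatives agree.\<close>

lemma torus_derivative_eq:
  assumes lift: "local_lift f U g" "x \<in> U" "abs_torus x = p"
    and L: "(g has_derivative L) (at x)"
  shows "torus_derivative f p = L"
  unfolding torus_derivative_def
proof (rule the_equality)
  show "\<exists>x U g. abs_torus x = p \<and> x \<in> U \<and> local_lift f U g \<and> (g has_derivative L) (at x)"
    using assms by blast
next
  fix L'
  assume "\<exists>x U g. abs_torus x = p \<and> x \<in> U \<and> local_lift f U g \<and> (g has_derivative L') (at x)"
  then obtain x' V h where h: "abs_torus x' = p" "x' \<in> V" "local_lift f V h"
    "(h has_derivative L') (at x')"
    by blast
  define m where "m = x' - x"
  have m: "m $ i \<in> \<int>" for i
    using h(1) lift(3) abs_torus_eq_iff[of x' x] by (simp add: m_def)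
  have hm: "((\<lambda>y. h (y + m)) has_derivative L') (at x)"
  proof -
    have "((\<lambda>y. y + m) has_derivative (\<lambda>v. v)) (at x)"
      by (auto intro!: derivative_eq_intros)
    from has_derivative_compose[OF this, of h L'] h(4) show ?thesis
      by (simp add: m_def)
  qed
  define d where "d = (\<lambda>y. h (y + m) - g y)"
  have "isCont d x"
    unfolding d_def using L hm by (intro continuous_diff) (auto intro: has_derivative_continuous)
  then have cont: "(d \<longlongrightarrow> d x) (nhds x)"
    by (simp add: isCont_def tendsto_at_iff_tendsto_nhds)
  have "\<forall>\<^sub>F y in nhds x. y \<in> U"
    using lift by (simp add: local_lift_def eventually_nhds_in_open)
  moreover have "\<forall>\<^sub>F y in nhds x. y + m \<in> V"
  proof -
    have "((\<lambda>y. y + m) \<longlongrightarrow> x + m) (nhds x)"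
      by (intro tendsto_add filterlim_ident tendsto_const)
    then show ?thesis
      using h by (intro topological_tendstoD) (auto simp: local_lift_def m_def)
  qed
  ultimately have "\<forall>\<^sub>F y in nhds x. \<forall>i. d y $ i \<in> \<int>"
  proof eventually_elim
    case (elim y)
    have "abs_torus (y + m) = abs_torus y"
      by (simp add: abs_torus_eq_iff m)
    then have "abs_torus (h (y + m)) = abs_torus (g y)"
      using elim lift h by (metis local_lift_def)
    then show ?case by (simp add: abs_torus_eq_iff d_def)
  qed
  from tendsto_int_vector_eventually_const[OF cont this]
  have ev: "\<forall>\<^sub>F y in nhds x. h (y + m) - d x = g y"
    by eventually_elim (simp add: d_def algebra_simps)
  have "((\<lambda>y. h (y + m) - d x) has_derivative L') (at x)"
    using has_derivative_diff[OF hm has_derivative_const[of "d x"]] by simp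
  then have "(g has_derivative L') (at x)"
    by (rule has_derivative_transform_eventually)
      (use ev eventually_nhds_x_imp_x[OF ev] in \<open>simp_all add: eventually_at_filter eventually_mono\<close>)
  then show "L' = L"
    using L has_derivative_unique by blast
qed

text \<open>Uniqueness of integral curves, one circle coordinate at a time: the coordinate of the
  orbit divided by the expected rotation is a function \<open>E\<close> of derivative zero, so it
  keeps its value at time 0.\<close>

lemma flow_constant_field:
  assumes flow: "is_flow_of \<phi> (constant_field a)"
  shows "\<phi> t (abs_torus x) = abs_torus (x + t *\<^sub>R a)"
proof (rule torus_eqI)
  fix i
  define c where "c = (\<lambda>s. \<phi> s (abs_torus x))"
  define E where "E = (\<lambda>s. circle_coord i (c s) * cis (- (2 * pi * (s * a $ i))))"
  have "(E has_vector_derivative 0) (at t)" for t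
  proof -
    have "has_velocity c (c t, a) t"
      using flow by (simp add: is_flow_of_def constant_field_def c_def)
    then obtain J g where J: "open J" "t \<in> J" "\<And>s. s \<in> J \<Longrightarrow> c s = abs_torus (g s)"
      and g: "(g has_vector_derivative a) (at t)"
      by (auto simp: has_velocity_def)
    \<comment> \<open>Near \<open>t\<close>, the local lift \<open>g\<close> of the orbit gives
      \<open>E s = cis (2 * pi * h s)\<close>, and \<open>h\<close> has derivative 0 at
      \<open>t\<close>.\<close>
    define h where "h = (\<lambda>s. g s $ i - s * a $ i)"
    have "((\<lambda>s. g s $ i) has_vector_derivative a $ i) (at t)"
      using bounded_linear.has_vector_derivative[OF bounded_linear_vec_nth g] .
    then have "(h has_vector_derivative (a $ i - a $ i)) (at t)"
      unfolding h_def
      by (intro has_vector_derivative_diff) (auto intro!: derivative_eq_intros)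
    then have h: "(h has_real_derivative 0) (at t)"
      by (simp add: has_real_derivative_iff_has_vector_derivative)
    have "((\<lambda>s. 2 * pi * h s) has_vector_derivative 0) (at t)"
      using DERIV_cmult[OF h, of "2 * pi"] by (simp add: has_real_derivative_iff_has_vector_derivative)
    from bounded_linear.has_vector_derivative[OF bounded_linear_of_real this]
    have "((\<lambda>s. \<i> * complex_of_real (2 * pi * h s)) has_vector_derivative 0) (at t)"
      using has_vector_derivative_mult_right[of "\<lambda>s. complex_of_real (2 * pi * h s)" 0 "at t" \<i>] by simp
    from field_vector_diff_chain_at[OF this DERIV_exp]
    have "((\<lambda>s. cis (2 * pi * h s)) has_vector_derivative 0) (at t)"
      by (simp add: cis_conv_exp o_def)
    then show ?thesis
    proof (rule has_vector_derivative_transform_within_open)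
      fix s assume "s \<in> J"
      then show "cis (2 * pi * h s) = E s"
        by (simp add: E_def J h_def cis_mult algebra_simps)
    qed (use J in auto)
  qed
  then have "E t = E 0"
    using has_derivative_zero_constant[of UNIV E] by (auto simp: has_vector_derivative_def)
  then have *: "circle_coord i (c t) * cis (- (2 * pi * (t * a $ i))) = cis (2 * pi * (x $ i))"
    using flow by (simp add: E_def c_def is_flow_of_def)
  have "circle_coord i (c t) = circle_coord i (c t) * cis (- (2 * pi * (t * a $ i))) * cis (2 * pi * (t * a $ i))"
    by (simp add: cis_mult mult.assoc)
  also have "\<dots> = cis (2 * pi * ((x + t *\<^sub>R a) $ i))"
    unfolding * by (simp add: cis_mult algebra_simps)
  finally show "circle_coord i (\<phi> t (abs_torus x)) = circle_coord i (abs_torus (x + t *\<^sub>R a))"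
    by (simp add: c_def)
qed

text \<open>Each circle coordinate of \<open>R\<close>, pulled back to \<open>real ^ 'n\<close>, is
  continuous and never zero. The space is contractible, so it has a continuous logarithm, whose
  imaginary part over \<open>2 * pi\<close> is a coordinate of the lift.\<close>

lemma continuous_lift_exists:
  assumes "smooth_torus_map R"
  obtains G where "continuous_on UNIV G" "\<And>x. R (abs_torus x) = abs_torus (G x)"
proof -
  have cont: "continuous_on UNIV (\<lambda>x. circle_coord i (R (abs_torus x)))" for i
  proof (subst continuous_on_eq_continuous_at, simp, rule ballI)
    fix x :: "real ^ 'a"
    obtain U g where U: "x \<in> U" "local_lift R U g" "smooth_on U g"
      using assms unfolding smooth_torus_map_def by blast
    have "continuous_on U g"
      using U(3) unfolding smooth_on_def by (metis times_differentiable_on.simps(1))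
    then have "continuous_on U (\<lambda>x. cis (2 * pi * g x $ i))"
      by (intro continuous_intros)
    then have "continuous_on U (\<lambda>x. circle_coord i (R (abs_torus x)))"
      by (rule continuous_on_eq) (use U in \<open>auto simp: local_lift_def\<close>)
    then show "isCont (\<lambda>x. circle_coord i (R (abs_torus x))) x"
      by (rule continuous_on_interior) (use U in \<open>simp add: local_lift_def interior_open\<close>)
  qed
  have "\<exists>g :: real ^ 'a \<Rightarrow> complex. continuous_on UNIV g \<and>
      (\<forall>x. circle_coord i (R (abs_torus x)) = exp (g x))" for i
    by (rule continuous_logarithm_on_contractible[OF cont[of i]])
      (auto simp: circle_coord_def convex_imp_contractible)
  then obtain g :: "'a \<Rightarrow> real ^ 'a \<Rightarrow> complex" where g: "\<And>i. continuous_on UNIV (g i)"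
    "\<And>i x. circle_coord i (R (abs_torus x)) = exp (g i x)"
    by metis
  define G :: "real ^ 'a \<Rightarrow> real ^ 'a" where "G = (\<lambda>x. \<chi> i. Im (g i x) / (2 * pi))"
  show thesis
  proof (rule that[of G])
    show "continuous_on UNIV G"
      unfolding G_def by (intro continuous_on_vec_lambda continuous_intros g) auto
    fix x
    show "R (abs_torus x) = abs_torus (G x)"
    proof (rule torus_eqI)
      fix i
      have "norm (exp (g i x)) = 1"
        unfolding g(2)[symmetric] circle_coord_def by simp
      then have "Re (g i x) = 0"
        by simp
      then have "exp (g i x) = cis (Im (g i x))"
        by (simp add: exp_eq_polar)
      then show "circle_coord i (R (abs_torus x)) = circle_coord i (abs_torus (G x))"
        by (simp add: g(2) G_def)
    qed
  qed
qed

section \<open>Additive functions, rational independence and periodicity\<close>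

lemma int_additive_eq_0:
  fixes k :: "real \<Rightarrow> real"
  assumes int: "\<And>t. k t \<in> \<int>" and add: "\<And>s t. k (s + t) = k s + k t"
  shows "k t = 0"
proof (rule ccontr)
  assume "k t \<noteq> 0"
  have mult: "k (of_nat n * u) = of_nat n * k u" for n u
  proof (induction n)
    case 0
    show ?case using add[of 0 0] by simp
  next
    case (Suc n)
    then show ?case using add[of u "of_nat n * u"] by (simp add: algebra_simps)
  qed
  \<comment> \<open>By additivity \<open>k t\<close> is \<open>n\<close> times the integer
    \<open>k (t / n)\<close>, for every positive \<open>n\<close>. A nonzero \<open>k t\<close>
    cannot be a multiple of an \<open>n\<close> larger than its absolute value.\<close>
  obtain n :: nat where n: "\<bar>k t\<bar> < of_nat n"
    using reals_Archimedean2 by blast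
  with \<open>k t \<noteq> 0\<close> have n0: "n > 0" by (cases n) auto
  then have kt: "k t = of_nat n * k (t / of_nat n)"
    using mult[of n "t / of_nat n"] by simp
  then have "1 \<le> \<bar>k (t / of_nat n)\<bar>"
    using \<open>k t \<noteq> 0\<close> int Ints_nonzero_abs_ge1 by (metis mult_zero_right)
  then have "of_nat n \<le> \<bar>k t\<bar>"
    unfolding kt using n0 by (simp add: abs_mult)
  with n show False by simp
qed

text \<open>If \<open>w t\<close> were nonzero, the values at the multiples of \<open>t\<close>
  would grow linearly.\<close>

lemma bounded_additive_eq_0:
  fixes w :: "real \<Rightarrow> 'a::real_normed_vector"
  assumes bnd: "\<And>t. norm (w t) \<le> B" and add: "\<And>s t. w (s + t) = w s + w t"
  shows "w t = 0"
proof (rule ccontr)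
  assume "w t \<noteq> 0"
  have mult: "w (of_nat n * u) = of_nat n *\<^sub>R w u" for n u
  proof (induction n)
    case 0
    show ?case using add[of 0 0] by simp
  next
    case (Suc n)
    then show ?case using add[of u "of_nat n * u"] by (simp add: algebra_simps)
  qed
  obtain n :: nat where "B < of_nat n * norm (w t)"
    using ex_less_of_nat_mult[of "norm (w t)" B] \<open>w t \<noteq> 0\<close> by auto
  also have "\<dots> = norm (w (of_nat n * t))"
    by (simp add: mult)
  finally show False using bnd[of "of_nat n * t"] by simp
qed

lemma rationally_independent_nth_nonzero:
  assumes "rationally_independent a"
  shows "a $ i \<noteq> 0"
proof
  assume "a $ i = 0"
  then have "(\<Sum>j\<in>UNIV. of_int (if j = i then 1 else 0) * a $ j) = 0"
    by (intro sum.neutral) auto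
  then show False
    using assms[unfolded rationally_independent_def, rule_format, of "\<lambda>j. if j = i then 1 else 0" i]
    by simp
qed

text \<open>Integers \<open>p = r * a $ i\<close> and \<open>q = r * a $ j\<close> give the relation
  \<open>q * a $ i - p * a $ j = 0\<close> with \<open>i\<close> and \<open>j\<close> distinct, so
  \<open>p = 0\<close>. In dimension one the inverse of the only coordinate would be a
  counterexample.\<close>

lemma rationally_independent_multiple_int:
  fixes a :: "real ^ 'n::finite"
  assumes ri: "rationally_independent a" and card: "CARD('n) \<ge> 2"
    and int: "\<And>i. r * a $ i \<in> \<int>"
  shows "r = 0"
proof (rule ccontr)
  assume r: "r \<noteq> 0"
  obtain i j :: 'n where ij: "i \<noteq> j"
  proof (rule ccontr)
    assume "\<not> thesis"
    then have "UNIV \<subseteq> {undefined :: 'n}" using that by blast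
    then have "CARD('n) \<le> 1"
      using card_mono[of "{undefined :: 'n}" UNIV] by simp
    with card show False by simp
  qed
  obtain p q where p: "r * a $ i = of_int p" and q: "r * a $ j = of_int q"
    using int by (meson Ints_cases)
  define m where "m = (\<lambda>k. if k = i then q else if k = j then - p else 0)"
  have "(\<Sum>k\<in>UNIV. of_int (m k) * a $ k) = (\<Sum>k\<in>{i, j}. of_int (m k) * a $ k)"
    by (rule sum.mono_neutral_right) (auto simp: m_def)
  also have "\<dots> = of_int q * a $ i - of_int p * a $ j"
    using ij by (simp add: m_def)
  also have "\<dots> = 0"
    by (simp flip: p q)
  finally have "m j = 0"
    using ri by (simp add: rationally_independent_def)
  then have "p = 0" using ij by (simp add: m_def)
  with p r have "a $ i = 0" by simp
  with ri show False by (simp add: rationally_independent_nth_nonzero)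
qed

lemma periodic_int_vector:
  fixes P :: "real ^ 'n::finite \<Rightarrow> 'b"
  assumes per: "\<And>x j. P (x + axis j 1) = P x" and int: "\<And>j. m $ j \<in> \<int>"
  shows "P (x + m) = P x"
proof -
  have nat: "P (x + of_nat n *\<^sub>R axis j 1) = P x" for x j and n :: nat
  proof (induction n arbitrary: x)
    case (Suc n)
    have "P (x + of_nat (Suc n) *\<^sub>R axis j 1) = P ((x + axis j 1) + of_nat n *\<^sub>R axis j 1)"
      by (simp add: algebra_simps)
    then show ?case by (simp only: Suc per)
  qed simp
  have mult: "P (x + of_int k *\<^sub>R axis j 1) = P x" for x j and k :: int
  proof (cases k rule: int_cases2)
    case (nonneg n)
    then show ?thesis using nat[of x n j] by simp
  next
    case (nonpos n)
    \<comment> \<open>For a negative multiple, start from the translated point and move forward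
      \<open>n\<close> steps to reach \<open>x\<close>.\<close>
    then show ?thesis using nat[of "x + of_int k *\<^sub>R axis j 1" n j] by simp
  qed
  have "P (x + (\<Sum>j\<in>S. m $ j *\<^sub>R axis j 1)) = P x" if "finite S" for S
    using that
  proof (induction S arbitrary: x)
    case (insert j S)
    obtain k where k: "m $ j = of_int k" using int by (meson Ints_cases)
    have "P (x + (\<Sum>j\<in>insert j S. m $ j *\<^sub>R axis j 1))
        = P ((x + of_int k *\<^sub>R axis j 1) + (\<Sum>j\<in>S. m $ j *\<^sub>R axis j 1))"
      using insert.hyps by (simp add: k algebra_simps)
    then show ?case by (simp only: insert.IH mult)
  qed simp
  from this[of UNIV] show ?thesis
    using basis_expansion[of m] by (simp add: scalar_mult_eq_scaleR)
qed

text \<open>The compact unit cube meets every class modulo integer translations.\<close>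

lemma periodic_bounded:
  fixes P :: "real ^ 'n::finite \<Rightarrow> 'b::real_normed_vector"
  assumes cont: "continuous_on UNIV P"
    and per: "\<And>x m. (\<And>j. m $ j \<in> \<int>) \<Longrightarrow> P (x + m) = P x"
  obtains B where "\<And>x. norm (P x) \<le> B"
proof -
  have "compact (P ` cbox 0 1)"
    using cont by (intro compact_continuous_image compact_cbox) (auto intro: continuous_on_subset)
  then obtain B where B: "\<And>y. y \<in> cbox 0 1 \<Longrightarrow> norm (P y) \<le> B"
    using compact_imp_bounded bounded_iff by (metis imageI)
  have "norm (P x) \<le> B" for x
  proof -
    define m :: "real ^ 'n" where "m = (\<chi> i. of_int \<lfloor>x $ i\<rfloor>)"
    have "x - m \<in> cbox 0 1"
      by (auto simp: mem_box_cart m_def) linarith+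
    then have "norm (P (x - m)) \<le> B" by (rule B)
    moreover have "P (x - m + m) = P (x - m)"
      by (rule per) (simp add: m_def)
    ultimately show ?thesis by simp
  qed
  then show thesis by (rule that)
qed

text \<open>This is the core of the argument, phrased for lifts: \<open>per\<close> says that
  \<open>G\<close> descends to the torus, \<open>conj\<close> that the induced map carries each time
  of the linear flow to some time. One number \<open>\<alpha>\<close> turns out to be both the
  eigenvalue and the factor of time change.\<close>

lemma translation_conjugating_lift_affine:
  fixes a :: "real ^ 'n::finite" and G :: "real ^ 'n \<Rightarrow> real ^ 'n"
  assumes ri: "rationally_independent a" and card: "CARD('n) \<ge> 2"
    and cont: "continuous_on UNIV G"
    and per: "\<And>x m i. (\<And>j. m $ j \<in> \<int>) \<Longrightarrow> (G (x + m) - G x) $ i \<in> \<int>"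
    and conj: "\<And>t. \<exists>s. \<forall>x i. (G (x + t *\<^sub>R a) - G x - s *\<^sub>R a) $ i \<in> \<int>"
  obtains \<alpha> and A :: "real ^ 'n ^ 'n" where "\<And>i j. A $ i $ j \<in> \<int>" "A *v a = \<alpha> *\<^sub>R a"
    "\<And>t x. G (x + t *\<^sub>R a) = G x + (\<alpha> * t) *\<^sub>R a"
proof -
  have contG: "continuous_on UNIV (\<lambda>x. G (x + m))" for m
    by (rule continuous_on_compose2[OF cont]) (auto intro!: continuous_intros)
  have lattice: "G (x + m) - G x = G m - G 0" if "\<And>j. m $ j \<in> \<int>" for x m
  proof -
    have "continuous_on UNIV (\<lambda>x. G (x + m) - G x)"
      by (intro continuous_on_diff contG cont)
    from continuous_int_vector_const[OF this per[OF that], of x 0] show ?thesis by simp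
  qed
  \<comment> \<open>Column \<open>j\<close> is the jump of \<open>G\<close> along the unit vector
    \<open>j\<close>, which by \<open>lattice\<close> is the same at every base point. Subtracting
    \<open>A\<close> therefore makes \<open>G\<close> periodic.\<close>
  define A :: "real ^ 'n ^ 'n" where "A = (\<chi> i j. (G (axis j 1) - G 0) $ i)"
  define P where "P = (\<lambda>x. G x - A *v x)"
  have A_int: "A $ i $ j \<in> \<int>" for i j
    using per[of "axis j 1" 0 i] by (simp add: A_def axis_def)
  have "P (x + axis j 1) = P x" for x j
  proof -
    have "A *v axis j 1 = G (axis j 1) - G 0"
      by (simp add: matrix_vector_mult_basis column_def A_def vec_eq_iff)
    moreover have "G (x + axis j 1) - G x = G (axis j 1) - G 0"
      by (rule lattice) (simp add: axis_def)
    ultimately have "G (x + axis j 1) - G x = A *v axis j 1" by simp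
    then show ?thesis
      by (simp add: P_def matrix_vector_right_distrib algebra_simps)
  qed
  then have P_per: "P (x + m) = P x" if "\<And>j. m $ j \<in> \<int>" for x m
    using that by (rule periodic_int_vector)
  have "continuous_on UNIV P"
    unfolding P_def by (intro continuous_intros cont matrix_vector_mult_linear_continuous_on)
  then obtain B where B: "\<And>x. norm (P x) \<le> B"
    using P_per periodic_bounded by blast
  \<comment> \<open>The time \<open>s t\<close> is picked separately for each \<open>t\<close>; no
    regularity in \<open>t\<close> is known yet.\<close>
  obtain s where s: "\<And>t x i. (G (x + t *\<^sub>R a) - G x - s t *\<^sub>R a) $ i \<in> \<int>"
    using conj by metis
  define v where "v = (\<lambda>t. G (t *\<^sub>R a) - G 0)"
  have v: "G (x + t *\<^sub>R a) = G x + v t" for x t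
  proof -
    have "continuous_on UNIV (\<lambda>x. G (x + t *\<^sub>R a) - G x - s t *\<^sub>R a)"
      by (intro continuous_on_diff continuous_on_const contG cont)
    from continuous_int_vector_const[OF this s, of x 0] show ?thesis
      by (simp add: v_def algebra_simps)
  qed
  have v_add: "v (t + u) = v t + v u" for t u
    using v[of 0 "t + u"] v[of "t *\<^sub>R a" u] v[of 0 t] by (simp add: scaleR_add_left)
  \<comment> \<open>The difference of the two sides is a difference of two values of the bounded
    function \<open>P\<close>, and it is additive in \<open>t\<close>.\<close>
  have v_lin: "v t = t *\<^sub>R (A *v a)" for t
  proof -
    define w where "w = (\<lambda>t. v t - t *\<^sub>R (A *v a))"
    have "w t = P (t *\<^sub>R a) - P 0" for t
      by (simp add: w_def v_def P_def matrix_vector_mult_scaleR)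
    then have "norm (w t) \<le> B + B" for t
      using norm_triangle_le_diff[of "P (t *\<^sub>R a)" "P 0" "B + B"] B[of "t *\<^sub>R a"] B[of 0] by simp
    then have "w t = 0"
      by (rule bounded_additive_eq_0) (simp add: w_def v_add algebra_simps)
    then show ?thesis by (simp add: w_def)
  qed
  \<comment> \<open>Since \<open>v\<close> is additive, the defect of \<open>s\<close> times each
    coordinate of \<open>a\<close> is an integer, which rational independence forces to be
    zero.\<close>
  have s_add: "s (t + u) = s t + s u" for t u
  proof -
    have "(s t + s u - s (t + u)) * a $ i \<in> \<int>" for i
    proof -
      have "(s t + s u - s (t + u)) * a $ i
          = (v (t + u) - s (t + u) *\<^sub>R a) $ i - (v t - s t *\<^sub>R a) $ i - (v u - s u *\<^sub>R a) $ i"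
        by (simp add: v_add algebra_simps)
      then show ?thesis
        using s[of 0 "t + u" i] s[of 0 t i] s[of 0 u i] by (simp only: v_def add_0_left Ints_diff)
    qed
    then have "s t + s u - s (t + u) = 0"
      using rationally_independent_multiple_int[OF ri card] by blast
    then show ?thesis by simp
  qed
  \<comment> \<open>The remaining integer vector is now additive in the real variable
    \<open>t\<close>, so it vanishes by divisibility.\<close>
  have v_s: "v t = s t *\<^sub>R a" for t
  proof -
    have "(v t - s t *\<^sub>R a) $ i = 0" for i
    proof (rule int_additive_eq_0[where k = "\<lambda>t. (v t - s t *\<^sub>R a) $ i"])
      show "(v t - s t *\<^sub>R a) $ i \<in> \<int>" for t
        using s[of 0 t i] by (simp add: v_def)
    qed (simp add: v_add s_add algebra_simps)
    then show ?thesis by (simp add: vec_eq_iff)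
  qed
  show thesis
  proof (rule that[OF A_int])
    show "A *v a = s 1 *\<^sub>R a"
      using v_lin[of 1] v_s[of 1] by simp
    then show "G (x + t *\<^sub>R a) = G x + (s 1 * t) *\<^sub>R a" for t x
      by (simp add: v v_lin mult.commute)
  qed
qed

section \<open>Characteristic polynomials of integer matrices\<close>

lemma map_poly_of_int_hom:
  fixes p q :: "int poly"
  shows "map_poly of_int (p * q) = (map_poly of_int p * map_poly of_int q :: 'a::comm_ring_1 poly)"
    and "map_poly of_int (p + q) = (map_poly of_int p + map_poly of_int q :: 'a poly)"
  by (auto intro!: poly_eqI simp: coeff_map_poly coeff_mult)

text \<open>The characteristic determinant is formed over \<open>int poly\<close>, which makes its
  coefficients integral by construction. Evaluation at \<open>\<alpha>\<close> gives the determinant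
  of a real matrix that kills the nonzero vector \<open>a\<close>.\<close>

lemma int_matrix_eigenvalue_poly:
  fixes A :: "real ^ 'n::finite ^ 'n"
  assumes int: "\<And>i j. A $ i $ j \<in> \<int>" and eig: "A *v a = \<alpha> *\<^sub>R a" and "a \<noteq> 0"
  obtains p :: "int poly" where "lead_coeff p = 1" "degree p = CARD('n)"
    "poly (map_poly of_int p) \<alpha> = 0"
proof -
  define M where "M = (\<lambda>i j. \<lfloor>A $ i $ j\<rfloor>)"
  have M: "A $ i $ j = of_int (M i j)" for i j
    using int[of i j] by (auto simp: M_def elim: Ints_cases)
  define C :: "int poly ^ 'n ^ 'n" where "C = (\<chi> i j. [:- M i j, if i = j then 1 else 0:])"
  define ev :: "int poly \<Rightarrow> real" where "ev = (\<lambda>p. poly (map_poly of_int p) \<alpha>)"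
  have ev_0 [simp]: "ev 0 = 0" and ev_1 [simp]: "ev 1 = 1"
    and ev_mult: "ev (p * q) = ev p * ev q" and ev_add: "ev (p + q) = ev p + ev q" for p q
    by (simp_all add: ev_def map_poly_of_int_hom)
  have ev_sum: "ev (sum f S) = (\<Sum>x\<in>S. ev (f x))" for f :: "('n \<Rightarrow> 'n) \<Rightarrow> int poly" and S
    by (induction S rule: infinite_finite_induct) (simp_all add: ev_add)
  have ev_prod: "ev (prod f S) = (\<Prod>x\<in>S. ev (f x))" for f :: "'n \<Rightarrow> int poly" and S
    by (induction S rule: infinite_finite_induct) (simp_all add: ev_mult)
  have ev_of_int: "ev (of_int k) = of_int k" for k
    by (simp add: ev_def of_int_poly map_poly_pCons)
  have ev_C: "ev (C $ i $ j) = (\<alpha> *\<^sub>R mat 1 - A) $ i $ j" for i j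
    by (simp add: ev_def C_def M map_poly_pCons mat_def)
  \<comment> \<open>\<open>ev\<close> is a ring homomorphism, so it passes through the Leibniz
    expansion.\<close>
  have "ev (det C) = det (\<alpha> *\<^sub>R mat 1 - A)"
    unfolding det_def by (simp only: ev_sum ev_mult ev_prod ev_of_int ev_C)
  moreover have "(\<alpha> *\<^sub>R mat 1 - A) *v a = 0"
    by (simp add: matrix_vector_mult_diff_rdistrib eig flip: scaleR_matrix_vector_assoc)
  then have "det (\<alpha> *\<^sub>R mat 1 - A) = 0"
    using \<open>a \<noteq> 0\<close> invertible_det_nz invertible_left_inverse matrix_left_invertible_ker by metis
  ultimately have root: "poly (map_poly of_int (det C)) \<alpha> = 0"
    by (simp add: ev_def)
  let ?term = "\<lambda>p. of_int (sign p) * (\<Prod>i\<in>UNIV. C $ i $ p i)"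
  let ?D = "\<Prod>i\<in>UNIV. C $ i $ i"
  let ?S = "{p. p permutes (UNIV :: 'n set)}"
  have degD: "degree ?D = CARD('n)"
    by (subst degree_prod_eq_sum_degree) (auto simp: C_def)
  have leadD: "lead_coeff ?D = 1"
    by (simp only: lead_coeff_prod) (simp add: C_def)
  \<comment> \<open>A permutation other than the identity moves some \<open>k\<close>; its factor at
    \<open>k\<close> is constant and all others have degree at most 1. Hence the diagonal product
    alone fixes the degree and the leading coefficient.\<close>
  have "degree (sum ?term (?S - {id})) < CARD('n)"
  proof (rule degree_sum_less)
    fix p assume p: "p \<in> ?S - {id}"
    then obtain k where k: "p k \<noteq> k" by (auto simp: fun_eq_iff)
    have "degree (?term p) \<le> degree (\<Prod>i\<in>UNIV. C $ i $ p i)"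
      using degree_mult_le[of "of_int (sign p)" "\<Prod>i\<in>UNIV. C $ i $ p i"] by simp
    also have "\<dots> \<le> (\<Sum>i\<in>UNIV. degree (C $ i $ p i))"
      using degree_prod_sum_le[of UNIV "\<lambda>i. C $ i $ p i"] by (simp add: o_def)
    also have "\<dots> < (\<Sum>i\<in>(UNIV :: 'n set). 1)"
      by (rule sum_strict_mono_ex1) (use k in \<open>auto simp: C_def intro!: exI[of _ k]\<close>)
    finally show "degree (?term p) < CARD('n)" by simp
  qed simp
  moreover have "det C = sum ?term (?S - {id}) + ?D"
    unfolding det_def by (subst sum.remove[of _ id]) (auto simp: permutes_id finite_permutations)
  ultimately have "degree (det C) = CARD('n)" "lead_coeff (det C) = 1"
    using degD leadD degree_add_eq_right[of "sum ?term (?S - {id})" ?D]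
      lead_coeff_add_le[of "sum ?term (?S - {id})" ?D] by auto
  with root show thesis by (intro that) auto
qed

section \<open>Smooth maps, the diffeomorphism group and normalizers\<close>

lemma times_differentiable_on_const: "times_differentiable_on k S (\<lambda>x. w)"
  by (induction k arbitrary: w) simp_all

lemma smooth_on_affine: "smooth_on S (\<lambda>x. c *\<^sub>R x + b)"
  unfolding smooth_on_def
proof
  fix k
  have D: "((\<lambda>x. c *\<^sub>R x + b) has_derivative (\<lambda>v. c *\<^sub>R v)) (at x)" for x
    by (auto intro!: derivative_eq_intros)
  show "times_differentiable_on k S (\<lambda>x. c *\<^sub>R x + b)"
  proof (cases k)
    case 0
    then show ?thesis by (auto intro!: continuous_intros)
  next
    case (Suc k)
    have "frechet_derivative (\<lambda>x. c *\<^sub>R x + b) (at x) = (\<lambda>v. c *\<^sub>R v)" for x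
      using frechet_derivative_at[OF D] by simp
    then show ?thesis
      using D by (auto simp: Suc times_differentiable_on_const differentiable_def)
  qed
qed

lemma smooth_torus_map_affine:
  assumes "\<And>x. f (abs_torus x) = abs_torus (c *\<^sub>R x + b)"
  shows "smooth_torus_map f"
proof -
  have "local_lift f UNIV (\<lambda>x. c *\<^sub>R x + b)"
    by (simp add: local_lift_def assms)
  then show ?thesis
    unfolding smooth_torus_map_def using smooth_on_affine by blast
qed

lemma carrier_Diff_iff:
  "f \<in> carrier Diff \<longleftrightarrow> bij f \<and> smooth_torus_map f \<and> smooth_torus_map (inv_into UNIV f)"
  by (simp add: Diff_def)

lemma carrier_DiffI:
  assumes "f \<circ> g = id" "g \<circ> f = id" "smooth_torus_map f" "smooth_torus_map g"
  shows "f \<in> carrier Diff" "inv_into UNIV f = g"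
proof -
  show inv: "inv_into UNIV f = g"
    using assms by (metis inv_unique_comp)
  show "f \<in> carrier Diff"
    using assms by (auto simp: carrier_Diff_iff inv intro: o_bij)
qed

lemma inv_in_carrier_Diff:
  assumes "f \<in> carrier Diff"
  shows "inv_into UNIV f \<in> carrier Diff"
  using assms by (simp add: carrier_Diff_iff bij_imp_bij_inv inv_inv_eq)

lemma inv_Diff:
  assumes f: "f \<in> carrier Diff"
  shows "inv\<^bsub>Diff\<^esub> f = inv_into UNIV f"
  unfolding m_inv_def
proof (rule the_equality)
  have "bij f" using f by (simp add: carrier_Diff_iff)
  then show "inv_into UNIV f \<in> carrier Diff \<and> f \<otimes>\<^bsub>Diff\<^esub> inv_into UNIV f = \<one>\<^bsub>Diff\<^esub> \<and>
      inv_into UNIV f \<otimes>\<^bsub>Diff\<^esub> f = \<one>\<^bsub>Diff\<^esub>"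
    using inv_in_carrier_Diff[OF f]
    by (auto simp: Diff_def bij_is_inj bij_is_surj surj_iff[symmetric] inj_iff[symmetric])
next
  fix g assume "g \<in> carrier Diff \<and> f \<otimes>\<^bsub>Diff\<^esub> g = \<one>\<^bsub>Diff\<^esub> \<and> g \<otimes>\<^bsub>Diff\<^esub> f = \<one>\<^bsub>Diff\<^esub>"
  then have "f \<circ> g = id" "g \<circ> f = id"
    by (simp_all add: Diff_def)
  then show "g = inv_into UNIV f"
    by (rule inv_unique_comp[symmetric])
qed

text \<open>\<open>normalizer\<close> is a stabiliser for conjugation acting on subsets of the
  carrier, hence the assumption on \<open>H\<close>. It demands equality of sets, not just
  inclusion.\<close>

lemma mem_normalizer_Diff_iff:
  assumes "H \<subseteq> carrier Diff"
  shows "R \<in> normalizer Diff H \<longleftrightarrow>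
    R \<in> carrier Diff \<and> (\<lambda>f. R \<circ> f \<circ> inv_into UNIV R) ` H = H"
proof -
  have "R <#\<^bsub>Diff\<^esub> H #>\<^bsub>Diff\<^esub> (inv\<^bsub>Diff\<^esub> R) = (\<lambda>f. R \<circ> f \<circ> inv_into UNIV R) ` H"
    if "R \<in> carrier Diff"
    using inv_Diff[OF that] by (auto simp: l_coset_def r_coset_def Diff_def)
  with assms show ?thesis
    by (auto simp: normalizer_def stabilizer_def)
qed

section \<open>Symmetries of an irrational flow and their multipliers\<close>

locale irrational_torus_flow =
  fixes a :: "real ^ 'n::finite" and \<phi> :: "real \<Rightarrow> 'n torus \<Rightarrow> 'n torus"
  assumes card_ge_2: "CARD('n) \<ge> 2"
    and independent: "rationally_independent a"
    and flow: "is_flow_of \<phi> (constant_field a)"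
begin

lemma flow_abs: "\<phi> t (abs_torus x) = abs_torus (x + t *\<^sub>R a)"
  using flow by (rule flow_constant_field)

lemma flow_add: "\<phi> s (\<phi> t p) = \<phi> (s + t) p"
  using abs_torus_surj[of p] by (auto simp: flow_abs algebra_simps)

text \<open>No orbit closes up, by rational independence, so a single point determines the
  time.\<close>

lemma flow_eqD: "\<phi> s p = \<phi> t p \<Longrightarrow> s = t"
proof -
  assume eq: "\<phi> s p = \<phi> t p"
  obtain x where "p = abs_torus x" using abs_torus_surj by metis
  with eq have "(s - t) * a $ i \<in> \<int>" for i
    by (simp add: flow_abs abs_torus_eq_iff algebra_simps)
  then have "s - t = 0"
    using rationally_independent_multiple_int independent card_ge_2 by blast
  then show "s = t" by simp
qed

lemma flow_in_Diff: "\<phi> t \<in> carrier Diff"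
proof (rule carrier_DiffI)
  have 0: "\<phi> 0 p = p" for p
    using flow by (simp add: is_flow_of_def)
  show "\<phi> t \<circ> \<phi> (- t) = id" "\<phi> (- t) \<circ> \<phi> t = id"
    by (simp_all add: fun_eq_iff flow_add 0)
  show "smooth_torus_map (\<phi> t)" "smooth_torus_map (\<phi> (- t))"
    by (rule smooth_torus_map_affine[where c = 1 and b = "t *\<^sub>R a"],
        simp add: flow_abs,
        rule smooth_torus_map_affine[where c = 1 and b = "(- t) *\<^sub>R a"],
        simp add: flow_abs)
qed

lemma symmetry_group_iff:
  "R \<in> symmetry_group \<phi> \<longleftrightarrow>
    R \<in> carrier Diff \<and> (\<lambda>f. R \<circ> f \<circ> inv_into UNIV R) ` range \<phi> = range \<phi>"
  unfolding symmetry_group_def by (rule mem_normalizer_Diff_iff) (use flow_in_Diff in auto)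

text \<open>The two conjuncts are the two inclusions, with \<open>R\<close> moved to the right-hand
  side. Passing to the inverse of \<open>R\<close> merely exchanges them.\<close>

lemma symmetry_group_iff_conj:
  assumes "R \<in> carrier Diff"
  shows "R \<in> symmetry_group \<phi> \<longleftrightarrow>
    (\<forall>t. \<exists>s. \<forall>p. R (\<phi> t p) = \<phi> s (R p)) \<and> (\<forall>s. \<exists>t. \<forall>p. R (\<phi> t p) = \<phi> s (R p))"
proof -
  have bij: "bij R" using assms by (simp add: carrier_Diff_iff)
  have "R \<circ> \<phi> t \<circ> inv_into UNIV R = \<phi> s \<longleftrightarrow> (\<forall>p. R (\<phi> t p) = \<phi> s (R p))" for s t
    using bij by (metis (no_types, opaque_lifting) bij_inv_eq_iff comp_apply ext)
  moreover have "range h = range k \<longleftrightarrow> (\<forall>t. \<exists>s. h t = k s) \<and> (\<forall>s. \<exists>t. h t = k s)"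
    for h k :: "real \<Rightarrow> 'n torus \<Rightarrow> 'n torus"
    by (simp add: set_eq_subset image_subset_iff image_iff) metis
  ultimately show ?thesis
    using assms unfolding symmetry_group_iff by (simp only: image_image simp_thms)
qed

lemma inv_symmetry:
  assumes "R \<in> symmetry_group \<phi>"
  shows "inv_into UNIV R \<in> symmetry_group \<phi>"
proof -
  have R: "R \<in> carrier Diff" using assms by (simp add: symmetry_group_iff)
  then have "bij R" by (simp add: carrier_Diff_iff)
  then have "(\<forall>p. inv_into UNIV R (\<phi> s p) = \<phi> t (inv_into UNIV R p)) \<longleftrightarrow>
      (\<forall>p. R (\<phi> t p) = \<phi> s (R p))" for s t
    by (metis bij_inv_eq_iff)
  then show ?thesis
    using assms unfolding symmetry_group_iff_conj[OF R]
      symmetry_group_iff_conj[OF inv_in_carrier_Diff[OF R]] by simp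
qed

text \<open>Normalising gives an unrelated time \<open>s\<close> for each \<open>t\<close>; a
  continuous lift and the result on lifts make it linear in \<open>t\<close>, with an eigenvalue of
  an integer matrix as slope.\<close>

lemma symmetry_eigenvalue:
  assumes "R \<in> symmetry_group \<phi>"
  obtains A :: "real ^ 'n ^ 'n" and \<alpha> where "\<And>i j. A $ i $ j \<in> \<int>" "A *v a = \<alpha> *\<^sub>R a"
    "\<And>t p. R (\<phi> t p) = \<phi> (\<alpha> * t) (R p)"
proof -
  have R: "R \<in> carrier Diff" using assms by (simp add: symmetry_group_iff)
  then obtain G where cont: "continuous_on UNIV G" and G: "\<And>x. R (abs_torus x) = abs_torus (G x)"
    using continuous_lift_exists carrier_Diff_iff by metis
  have per: "(G (x + m) - G x) $ i \<in> \<int>" if "\<And>j. m $ j \<in> \<int>" for x m i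
  proof -
    have "abs_torus (x + m) = abs_torus x"
      using that by (simp add: abs_torus_eq_iff)
    then have "abs_torus (G (x + m)) = abs_torus (G x)"
      by (simp flip: G)
    then show ?thesis by (simp add: abs_torus_eq_iff)
  qed
  have conj: "\<exists>s. \<forall>x i. (G (x + t *\<^sub>R a) - G x - s *\<^sub>R a) $ i \<in> \<int>" for t
  proof -
    obtain s where "\<And>p. R (\<phi> t p) = \<phi> s (R p)"
      using assms symmetry_group_iff_conj[OF R] by metis
    then have "abs_torus (G (x + t *\<^sub>R a)) = abs_torus (G x + s *\<^sub>R a)" for x
      by (metis G flow_abs)
    then show ?thesis
      by (auto simp: abs_torus_eq_iff algebra_simps)
  qed
  show thesis
  proof (rule translation_conjugating_lift_affine[OF independent card_ge_2 cont])
    show "(G (x + m) - G x) $ i \<in> \<int>" if "\<And>j. m $ j \<in> \<int>" for x m i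
      using that by (rule per)
    show "\<exists>s. \<forall>x i. (G (x + t *\<^sub>R a) - G x - s *\<^sub>R a) $ i \<in> \<int>" for t
      by (rule conj)
    fix \<alpha> and A :: "real ^ 'n ^ 'n"
    assume A: "\<And>i j. A $ i $ j \<in> \<int>" "A *v a = \<alpha> *\<^sub>R a"
      and lin: "\<And>t x. G (x + t *\<^sub>R a) = G x + (\<alpha> * t) *\<^sub>R a"
    have "R (\<phi> t p) = \<phi> (\<alpha> * t) (R p)" for t p
      using abs_torus_surj[of p] by (auto simp: flow_abs G lin)
    with A show thesis by (rule that)
  qed
qed

text \<open>\<open>multiplier\<close> is defined by the pushforward, so the conjugation identity is
  differentiated at time 0 along the orbit.\<close>

lemma multiplier_eq:
  assumes R: "R \<in> carrier Diff" and "\<alpha> \<noteq> 0"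
    and conj: "\<And>t p. R (\<phi> t p) = \<phi> (\<alpha> * t) (R p)"
  shows "multiplier (constant_field a) R = \<alpha>"
proof -
  have deriv: "torus_derivative R p a = \<alpha> *\<^sub>R a" for p
  proof -
    obtain x where x: "abs_torus x = p" using abs_torus_surj by metis
    obtain U g where U: "x \<in> U" and lift: "local_lift R U g" and smooth: "smooth_on U g"
      using R unfolding carrier_Diff_iff smooth_torus_map_def by metis
    have "times_differentiable_on (Suc 0) U g"
      using smooth unfolding smooth_on_def by blast
    then have "g differentiable at x" using U by simp
    then obtain L where L: "(g has_derivative L) (at x)"
      by (auto simp: differentiable_def)
    \<comment> \<open>In a local lift the identity holds only modulo integers. The error
      \<open>d\<close> vanishes at 0 and is continuous there, hence is zero for small
      \<open>t\<close>, which gives \<open>L a = \<alpha> *\<^sub>R a\<close>.\<close>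
    define d where "d = (\<lambda>t. g (x + t *\<^sub>R a) - g x - (\<alpha> * t) *\<^sub>R a)"
    have "((\<lambda>t. x + t *\<^sub>R a) has_derivative (\<lambda>t. t *\<^sub>R a)) (at 0)"
      by (auto intro!: derivative_eq_intros)
    from has_derivative_compose[OF this, of g L] L
    have gt: "((\<lambda>t. g (x + t *\<^sub>R a)) has_derivative (\<lambda>t. L (t *\<^sub>R a))) (at 0)"
      by simp
    then have dt: "(d has_derivative (\<lambda>t. L (t *\<^sub>R a) - (\<alpha> * t) *\<^sub>R a)) (at 0)"
      unfolding d_def by (auto intro!: derivative_eq_intros)
    then have cont: "(d \<longlongrightarrow> d 0) (nhds 0)"
      using has_derivative_continuous[OF dt] by (simp add: isCont_def tendsto_at_iff_tendsto_nhds)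
    have "((\<lambda>t. x + t *\<^sub>R a) \<longlongrightarrow> x + 0 *\<^sub>R a) (nhds 0)"
      by (intro tendsto_add tendsto_scaleR filterlim_ident tendsto_const)
    then have "\<forall>\<^sub>F t in nhds 0. x + t *\<^sub>R a \<in> U"
      using U lift by (intro topological_tendstoD) (auto simp: local_lift_def)
    then have "\<forall>\<^sub>F t in nhds 0. \<forall>i. d t $ i \<in> \<int>"
    proof eventually_elim
      case (elim t)
      have "abs_torus (g (x + t *\<^sub>R a)) = R (\<phi> t (abs_torus x))"
        using elim lift by (simp add: local_lift_def flow_abs)
      also have "\<dots> = \<phi> (\<alpha> * t) (R (abs_torus x))"
        by (rule conj)
      also have "\<dots> = abs_torus (g x + (\<alpha> * t) *\<^sub>R a)"
        using U lift by (simp add: local_lift_def flow_abs)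
      finally show ?case by (simp add: abs_torus_eq_iff d_def algebra_simps)
    qed
    from tendsto_int_vector_eventually_const[OF cont this]
    have ev: "\<forall>\<^sub>F t in nhds 0. d t = 0" by (simp add: d_def)
    have "((\<lambda>t. 0) has_derivative (\<lambda>t. L (t *\<^sub>R a) - (\<alpha> * t) *\<^sub>R a)) (at (0::real))"
      using dt by (rule has_derivative_transform_eventually)
        (use ev eventually_nhds_x_imp_x[OF ev] in \<open>simp_all add: eventually_at_filter eventually_mono\<close>)
    then have "(\<lambda>t. L (t *\<^sub>R a) - (\<alpha> * t) *\<^sub>R a) = (\<lambda>t. 0)"
      using has_derivative_unique has_derivative_const by blast
    from fun_cong[OF this, of 1] have "L a = \<alpha> *\<^sub>R a" by simp
    then show ?thesis
      using torus_derivative_eq[OF lift U x L] by simp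
  qed
  have "surj R" using R by (simp add: carrier_Diff_iff bij_is_surj)
  then have push: "pushforward R (constant_field a) = (\<lambda>p. (p, \<alpha> *\<^sub>R a))"
    by (simp add: pushforward_def tangent_map_def constant_field_def fun_eq_iff deriv surj_f_inv_f)
  \<comment> \<open>A nonzero field makes the scalar in \<open>multiplier\<close> unique.\<close>
  have "a \<noteq> 0"
    using rationally_independent_nth_nonzero[OF independent] by force
  then show ?thesis
    unfolding multiplier_def push using \<open>\<alpha> \<noteq> 0\<close>
    by (intro the_equality) (auto simp: scale_field_def constant_field_def fun_eq_iff)
qed

text \<open>The eigenvalue result is applied to \<open>R\<close> and to its inverse. Composing the
  two takes time 1 to time \<open>\<beta> * \<gamma>\<close>, and \<open>flow_eqD\<close> makes this
  product 1.\<close>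

lemma symmetry_multiplier:
  assumes "R \<in> symmetry_group \<phi>"
  defines "\<alpha> \<equiv> multiplier (constant_field a) R"
  obtains A B :: "real ^ 'n ^ 'n" where "\<alpha> \<noteq> 0"
    "\<And>i j. A $ i $ j \<in> \<int>" "A *v a = \<alpha> *\<^sub>R a"
    "\<And>i j. B $ i $ j \<in> \<int>" "B *v a = inverse \<alpha> *\<^sub>R a"
proof -
  obtain A :: "real ^ 'n ^ 'n" and \<beta> where A: "\<And>i j. A $ i $ j \<in> \<int>" "A *v a = \<beta> *\<^sub>R a"
    and \<beta>: "\<And>t p. R (\<phi> t p) = \<phi> (\<beta> * t) (R p)"
    by (rule symmetry_eigenvalue[OF assms(1)]) (rule that)
  obtain B :: "real ^ 'n ^ 'n" and \<gamma> where B: "\<And>i j. B $ i $ j \<in> \<int>" "B *v a = \<gamma> *\<^sub>R a"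
    and \<gamma>: "\<And>t p. inv_into UNIV R (\<phi> t p) = \<phi> (\<gamma> * t) (inv_into UNIV R p)"
    by (rule symmetry_eigenvalue[OF inv_symmetry[OF assms(1)]]) (rule that)
  have R: "R \<in> carrier Diff" using assms by (simp add: symmetry_group_iff)
  then have "surj R" by (simp add: carrier_Diff_iff bij_is_surj)
  then have "\<phi> 1 p = \<phi> (\<beta> * \<gamma>) p" for p
    using surj_f_inv_f[of R "\<phi> 1 p"] surj_f_inv_f[of R p] by (simp add: \<beta> \<gamma>)
  then have "\<beta> * \<gamma> = 1" using flow_eqD by metis
  then have "\<beta> \<noteq> 0" and \<gamma>_eq: "\<gamma> = inverse \<beta>"
    by (auto simp: inverse_unique)
  then have "\<alpha> = \<beta>"
    unfolding \<alpha>_def by (intro multiplier_eq R \<beta>)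
  with A B \<gamma>_eq \<open>\<beta> \<noteq> 0\<close> show thesis
    by (intro that[of A B]) simp_all
qed

lemma eigenvalue_algebraic_int:
  fixes A :: "real ^ 'n ^ 'n"
  assumes "\<And>i j. A $ i $ j \<in> \<int>" "A *v a = \<alpha> *\<^sub>R a"
  shows "algebraic_int \<alpha>" "algebraic_int_degree \<alpha> \<le> CARD('n)"
proof -
  have "a \<noteq> 0"
    using rationally_independent_nth_nonzero[OF independent] by force
  then obtain p :: "int poly" where p: "lead_coeff p = 1" "degree p = CARD('n)"
    "poly (map_poly of_int p) \<alpha> = 0"
    using int_matrix_eigenvalue_poly[OF assms] by metis
  then show "algebraic_int \<alpha>" by (auto simp: algebraic_int_altdef_ipoly)
  show "algebraic_int_degree \<alpha> \<le> CARD('n)"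
    unfolding algebraic_int_degree_def using p by (intro Least_le exI[of _ p] conjI)
qed

text \<open>As \<open>c * c = 1\<close>, the map is its own inverse, and the time
  \<open>c * s\<close> is carried to \<open>s\<close>.\<close>

lemma scaling_symmetry:
  assumes f: "\<And>x. f (abs_torus x) = abs_torus (c *\<^sub>R x)" and c: "c * c = 1"
  shows "f \<in> symmetry_group \<phi>" "multiplier (constant_field a) f = c"
proof -
  have "f (f p) = p" for p
    using abs_torus_surj[of p] by (auto simp: f c)
  moreover have "smooth_torus_map f"
    by (rule smooth_torus_map_affine[where b = 0]) (simp add: f)
  ultimately have D: "f \<in> carrier Diff"
    by (intro carrier_DiffI(1)[of f f]) (auto simp: fun_eq_iff)
  have conj: "f (\<phi> t p) = \<phi> (c * t) (f p)" for t p
    using abs_torus_surj[of p] by (auto simp: f flow_abs scaleR_add_right)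
  moreover have "f (\<phi> (c * s) p) = \<phi> s (f p)" for s p
    by (simp add: conj c flip: mult.assoc)
  ultimately show "f \<in> symmetry_group \<phi>"
    using symmetry_group_iff_conj[OF D] by blast
  show "multiplier (constant_field a) f = c"
    using c by (intro multiplier_eq D conj) auto
qed

lemma one_minus_one_multipliers:
  "{1, -1} \<subseteq> multiplier (constant_field a) ` symmetry_group \<phi>"
proof -
  have "id (abs_torus x) = abs_torus (1 *\<^sub>R x)" for x :: "real ^ 'n"
    by simp
  from scaling_symmetry[OF this]
  have "1 \<in> multiplier (constant_field a) ` symmetry_group \<phi>" by force
  moreover
  \<comment> \<open>Inversion of the torus, computed on representatives: an integer change of
    representative only changes sign.\<close>
  have "abs_torus (- rep_torus (abs_torus x)) = abs_torus ((- 1) *\<^sub>R x)" for x :: "real ^ 'n"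
  proof -
    have "abs_torus (rep_torus (abs_torus x)) = abs_torus x"
      by (rule abs_rep_torus)
    then show ?thesis
      by (simp add: abs_torus_eq_iff) (metis Ints_minus minus_diff_eq)
  qed
  from scaling_symmetry[OF this]
  have "-1 \<in> multiplier (constant_field a) ` symmetry_group \<phi>" by force
  ultimately show ?thesis by simp
qed

end

section \<open>Integrality and the rational multipliers\<close>

theorem corollary4p4:
  fixes a :: "real ^ 'n::finite"
    and X :: "'n torus \<Rightarrow> 'n tangent"
    and \<phi> :: "real \<Rightarrow> 'n torus \<Rightarrow> 'n torus"
  assumes "CARD('n) \<ge> 2"
    and "rationally_independent a"
    and "X = constant_field a"
    and "is_flow_of \<phi> X"
  shows "(\<forall>\<alpha> \<in> multiplier X ` symmetry_group \<phi>.
            algebraic_int \<alpha> \<and> algebraic_int_degree \<alpha> \<le> CARD('n)) \<and>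
         multiplier X ` symmetry_group \<phi> \<inter> \<rat> = {1, -1}"
proof -
  interpret irrational_torus_flow a \<phi>
    using assms by unfold_locales simp_all
  have main: "algebraic_int \<alpha> \<and> algebraic_int_degree \<alpha> \<le> CARD('n) \<and> (\<alpha> \<in> \<rat> \<longrightarrow> \<alpha> \<in> {1, -1})"
    if \<alpha>: "\<alpha> \<in> multiplier X ` symmetry_group \<phi>" for \<alpha>
  proof -
    obtain R where R: "R \<in> symmetry_group \<phi>" and "\<alpha> = multiplier (constant_field a) R"
      using \<alpha> assms(3) by blast
    then obtain A B :: "real ^ 'n ^ 'n" where "\<alpha> \<noteq> 0"
      and A: "\<And>i j. A $ i $ j \<in> \<int>" "A *v a = \<alpha> *\<^sub>R a"
      and B: "\<And>i j. B $ i $ j \<in> \<int>" "B *v a = inverse \<alpha> *\<^sub>R a"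
      using symmetry_multiplier[OF R] by metis
    have "\<alpha> \<in> {1, -1}" if "\<alpha> \<in> \<rat>"
    proof -
      \<comment> \<open>Rational algebraic integers are integers. This applies to the multiplier and
        to its inverse, so the multiplier is a unit of the integers.\<close>
      have "\<alpha> \<in> \<int>" "inverse \<alpha> \<in> \<int>"
        using that eigenvalue_algebraic_int(1)[OF A] eigenvalue_algebraic_int(1)[OF B]
        by (auto intro: rational_algebraic_int_is_int)
      then obtain k l where kl: "\<alpha> = of_int k" "inverse \<alpha> = of_int l"
        by (auto elim!: Ints_cases)
      then have "of_int (k * l) = (1 :: real)"
        using \<open>\<alpha> \<noteq> 0\<close> by (metis of_int_mult right_inverse)
      then have "k * l = 1" by (simp only: of_int_eq_1_iff)
      then show ?thesis using kl(1) zmult_eq_1_iff by auto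
    qed
    then show ?thesis using eigenvalue_algebraic_int[OF A] by blast
  qed
  have "{1, -1} \<subseteq> multiplier X ` symmetry_group \<phi>"
    using one_minus_one_multipliers assms(3) by simp
  moreover have "{1, -1} \<subseteq> (\<rat> :: real set)" by simp
  ultimately show ?thesis using main by blast
qed

end
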